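(* The set of extreme points of $\mathsf B_{\mathfrak O}$ is $$\operatorname{ext}(\mathsf B_{\mathfrak O})=\bigcup_{j=1}^4\bigl(\Gamma_j\cup(-\Gamma_j)\bigr)\cup\{\pm p_0,\pm p_1,\pm p_2,\pm p_3\}.$$
   Context: Let $\tau=\sqrt2-1$, $\sigma=\tau-\tau^2=3\sqrt2-4$, and $\mathfrak O=\{(x,y)\in[0,1]^2: x+y\le\sqrt2\}$. A triple $(a,b,c)\in\mathbb R^3$ is identified with the quadratic form $P(x,y)=ax^2+bxy+cy^2$, and $\|(a,b,c)\|_{\mathfrak O}=\sup\{|P(x,y)|:(x,y)\in\mathfrak O\}$. Let $\mathsf B_{\mathfrak O}=\{(a,b,c)\in\mathbb R^3:\|(a,b,c)\|_{\mathfrak O}\le1\}$, and let $\operatorname{ext}$ denote the set of extreme points of a convex set. With coordinates ordered as $(a,b,c)$, define the curves $$\Gamma_1=\{(-1,2\sqrt{1-t},t):2\tau\le t\le1\},$$ $$\Gamma_2=\{(-1,1+\sqrt{3(1-2t)},t):-1\le t\le\sigma\},$$ $$\Gamma_3=\{(t,1+\sqrt{3(1-2t)},-1):-1\le t\le\sigma\},$$ $$\Gamma_4=\{(t,2\sqrt{1-t},-1):2\tau\le t\le1\},$$ with $-\Gamma_j=\{-p:p\in\Gamma_j\}$, and the points $$p_0=(0,0,1),\quad p_1=(1,0,0),\quad p_2=\left(\tfrac12,1,\tfrac12\right),\quad p_3=(1,-\tau,1).$$ *)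

theory Defs
  imports "HOL-Analysis.Analysis"
begin

definition tau :: real where
  "tau = sqrt 2 - 1"

definition sigma :: real where
  "sigma = tau - tau\<^sup>2"

lemma sigma_eq: "sigma = 3 * sqrt 2 - 4"
  by (simp add: sigma_def tau_def power2_eq_square algebra_simps)

definition Oct :: "(real \<times> real) set" where
  "Oct = {(x, y). x \<in> {0..1} \<and> y \<in> {0..1} \<and> x + y \<le> sqrt 2}"

definition qform :: "real \<times> real \<times> real \<Rightarrow> real \<Rightarrow> real \<Rightarrow> real" where
  "qform = (\<lambda>(a, b, c) x y. a * x\<^sup>2 + b * x * y + c * y\<^sup>2)"

definition norm_Oct :: "real \<times> real \<times> real \<Rightarrow> real" where
  "norm_Oct p = (SUP (x, y)\<in>Oct. \<bar>qform p x y\<bar>)"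

text \<open>The supremum is over a nonempty set of reals that is bounded above, so it is a genuine one.\<close>

lemma Oct_nonempty: "Oct \<noteq> {}"
proof -
  have "(0, 0) \<in> Oct"
    by (simp add: Oct_def)
  then show ?thesis
    by blast
qed

lemma bdd_above_qform_Oct: "bdd_above ((\<lambda>(x, y). \<bar>qform p x y\<bar>) ` Oct)"
proof -
  have "bounded ((\<lambda>(x, y). \<bar>qform p x y\<bar>) ` ({0..1} \<times> {0..1}))"
    unfolding qform_def case_prod_unfold
    by (intro compact_imp_bounded compact_continuous_image continuous_intros compact_Times) auto
  then have "bdd_above ((\<lambda>(x, y). \<bar>qform p x y\<bar>) ` ({0..1} \<times> {0..1}))"
    by (rule bounded_imp_bdd_above)
  then show ?thesis
    by (rule bdd_above_mono) (auto simp: Oct_def)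
qed

definition ball_Oct :: "(real \<times> real \<times> real) set" where
  "ball_Oct = {p. norm_Oct p \<le> 1}"

definition Gamma1 :: "(real \<times> real \<times> real) set" where
  "Gamma1 = {(-1, 2 * sqrt (1 - t), t) | t. 2 * tau \<le> t \<and> t \<le> 1}"

definition Gamma2 :: "(real \<times> real \<times> real) set" where
  "Gamma2 = {(-1, 1 + sqrt (3 * (1 - 2 * t)), t) | t. -1 \<le> t \<and> t \<le> sigma}"

definition Gamma3 :: "(real \<times> real \<times> real) set" where
  "Gamma3 = {(t, 1 + sqrt (3 * (1 - 2 * t)), -1) | t. -1 \<le> t \<and> t \<le> sigma}"

definition Gamma4 :: "(real \<times> real \<times> real) set" where
  "Gamma4 = {(t, 2 * sqrt (1 - t), -1) | t. 2 * tau \<le> t \<and> t \<le> 1}"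

definition p0 :: "real \<times> real \<times> real" where "p0 = (0, 0, 1)"
definition p1 :: "real \<times> real \<times> real" where "p1 = (1, 0, 0)"
definition p2 :: "real \<times> real \<times> real" where "p2 = (1/2, 1, 1/2)"
definition p3 :: "real \<times> real \<times> real" where "p3 = (1, - tau, 1)"

end

theory Submission
  imports Defs
begin

text \<open>By homogeneity, \<open>P\<close> is controlled by its values on the three edges of \<open>Oct\<close> away from
  the origin, on which the forms \<open>x\<^sup>2\<close>, \<open>y\<^sup>2\<close> and \<open>(x + y)\<^sup>2 / 2\<close> (the points \<open>p1\<close>, \<open>p0\<close>, \<open>p2\<close>)
  are constantly \<open>1\<close>.
  Let \<open>P\<close> be extreme. The middle coefficient cannot be moved in both directions, so up to sign
  it is maximal, and \<open>P = 1\<close> at some point of these edges. If this point lies inside an edge with edge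
  form \<open>\<ell>\<close>, then \<open>\<ell> - P\<close> vanishes there to second order, so it is \<open>k\<close> times the square of a
  linear form; moving \<open>k\<close> places \<open>P\<close> on a segment from \<open>\<ell>\<close> to a point of one of the four curves.
  If the point is the vertex \<open>(tau, 1)\<close>, then the one-sided derivatives along
  the two adjacent edges, the bounds \<open>-1 \<le> a\<close> and \<open>c \<le> 1\<close>, and the value at \<open>(1, tau)\<close> confine
  \<open>P\<close> to a pentagon spanned by points of the list; the vertex \<open>(1, tau)\<close> is symmetric.
  Conversely, if both \<open>P + D\<close> and \<open>P - D\<close> lie in the ball, then \<open>\<bar>D\<bar> \<le> 1 - P\<close> where \<open>P\<close> has
  a double contact, which forces \<open>D = 0\<close>.\<close>

section \<open>The unit ball\<close>

lemma sqrt2_eq: "sqrt 2 = 1 + tau"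
  by (simp add: tau_def)

lemma tau_squared: "tau\<^sup>2 = 1 - 2 * tau"
  by (simp add: tau_def power2_eq_square algebra_simps)

lemma tau_bounds: "2/5 < tau" "tau < 1/2"
proof -
  have "sqrt ((7/5)\<^sup>2) < sqrt 2" "sqrt 2 < sqrt ((3/2)\<^sup>2)"
    by (simp_all only: real_sqrt_less_iff) (simp_all add: power2_eq_square)
  then show "2/5 < tau" "tau < 1/2"
    by (simp_all add: tau_def)
qed

lemma sigma_tau: "sigma = 3 * tau - 1"
  by (simp add: sigma_def tau_squared)

lemma mem_Oct: "(x, y) \<in> Oct \<longleftrightarrow> 0 \<le> x \<and> x \<le> 1 \<and> 0 \<le> y \<and> y \<le> 1 \<and> x + y \<le> 1 + tau"
  by (auto simp: Oct_def sqrt2_eq)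

lemma compact_Oct: "compact Oct"
proof -
  have "Oct = ({0..1} \<times> {0..1}) \<inter> {z. fst z + snd z \<le> sqrt 2}"
    by (auto simp: Oct_def)
  moreover have "closed {z :: real \<times> real. fst z + snd z \<le> sqrt 2}"
    by (intro closed_Collect_le continuous_intros)
  ultimately show ?thesis
    by (metis compact_Int_closed compact_Times compact_Icc)
qed

lemma qform_eq: "qform (a, b, c) x y = a * x\<^sup>2 + b * x * y + c * y\<^sup>2"
  by (simp add: qform_def)

lemma qform_add: "qform (p + q) x y = qform p x y + qform q x y"
  by (cases p; cases q) (simp add: qform_eq algebra_simps)

lemma qform_scaleR: "qform (r *\<^sub>R p) x y = r * qform p x y"
  by (cases p) (simp add: qform_eq algebra_simps)

lemma qform_minus: "qform (- p) x y = - qform p x y"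
  by (cases p) (simp add: qform_eq algebra_simps)

lemma qform_diff: "qform (p - q) x y = qform p x y - qform q x y"
  using qform_add[of p "- q"] by (simp add: qform_minus)

text \<open>Removes the supremum: from here on the ball is handled through pointwise bounds on
  \<open>Oct\<close>.\<close>

lemma mem_ball_Oct: "p \<in> ball_Oct \<longleftrightarrow> (\<forall>x y. (x, y) \<in> Oct \<longrightarrow> \<bar>qform p x y\<bar> \<le> 1)"
  unfolding ball_Oct_def norm_Oct_def
  by (subst mem_Collect_eq, subst cSUP_le_iff[OF Oct_nonempty bdd_above_qform_Oct]) auto

lemma ball_OctD:
  assumes "p \<in> ball_Oct" "(x, y) \<in> Oct"
  shows "qform p x y \<le> 1" "- 1 \<le> qform p x y"
  using assms unfolding mem_ball_Oct by (fastforce simp: abs_le_iff)+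

lemma ball_Oct_coeff_bounds:
  assumes "(a, b, c) \<in> ball_Oct"
  shows "a \<le> 1" "- 1 \<le> a" "c \<le> 1" "- 1 \<le> c"
  using ball_OctD[OF assms, of 1 0] ball_OctD[OF assms, of 0 1] tau_bounds
  by (auto simp: qform_eq mem_Oct)

lemma convex_ball_Oct: "convex ball_Oct"
proof (rule convexI)
  fix p q :: "real \<times> real \<times> real" and u v :: real
  assume pq: "p \<in> ball_Oct" "q \<in> ball_Oct" and uv: "0 \<le> u" "0 \<le> v" "u + v = 1"
  show "u *\<^sub>R p + v *\<^sub>R q \<in> ball_Oct"
    unfolding mem_ball_Oct
  proof (intro allI impI)
    fix x y assume xy: "(x, y) \<in> Oct"
    have "u * qform p x y \<le> u * 1" "v * qform q x y \<le> v * 1"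
      "u * (- 1) \<le> u * qform p x y" "v * (- 1) \<le> v * qform q x y"
      using ball_OctD[OF pq(1) xy] ball_OctD[OF pq(2) xy] uv by (intro mult_left_mono; simp)+
    then show "\<bar>qform (u *\<^sub>R p + v *\<^sub>R q) x y\<bar> \<le> 1"
      using uv by (simp add: qform_add qform_scaleR abs_le_iff)
  qed
qed

section \<open>Extreme points of convex sets\<close>

text \<open>If \<open>p\<close> lay strictly between two points of \<open>S\<close>, a small
  multiple of their difference could be both added and subtracted without leaving
  \<open>S\<close>.\<close>

lemma extreme_point_ofI_perturb:
  assumes S: "convex S" "p \<in> S"
    and unique: "\<And>d. p + d \<in> S \<Longrightarrow> p - d \<in> S \<Longrightarrow> d = 0"
  shows "p extreme_point_of S"
  unfolding extreme_point_of_def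
proof (intro conjI ballI notI S(2))
  fix q r assume qr: "q \<in> S" "r \<in> S" "p \<in> open_segment q r"
  then obtain u where u: "q \<noteq> r" "0 < u" "u < 1" "p = (1 - u) *\<^sub>R q + u *\<^sub>R r"
    by (auto simp: in_segment)
  \<comment> \<open>The distance from \<open>u\<close> to the nearer end of the unit interval, so
    that \<open>u + m\<close> and \<open>u - m\<close> both stay in it.\<close>
  define m where "m = min u (1 - u)"
  have m: "0 < m" "m \<le> u" "u + m \<le> 1"
    using u by (auto simp: m_def)
  have segment: "(1 - v) *\<^sub>R q + v *\<^sub>R r \<in> S" if "0 \<le> v" "v \<le> 1" for v
    using convexD_alt[OF S(1) qr(1,2) that] .
  have "p + m *\<^sub>R (r - q) = (1 - (u + m)) *\<^sub>R q + (u + m) *\<^sub>R r"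
    "p - m *\<^sub>R (r - q) = (1 - (u - m)) *\<^sub>R q + (u - m) *\<^sub>R r"
    by (simp_all add: u(4) algebra_simps)
  then have "m *\<^sub>R (r - q) = 0"
    using segment[of "u + m"] segment[of "u - m"] m u by (intro unique) auto
  then show False
    using m u by simp
qed

lemma extreme_point_of_segment_endpoint:
  assumes "p extreme_point_of S" "q \<in> S" "r \<in> S" "q \<noteq> r"
    and "0 \<le> u" "u \<le> 1" "p = (1 - u) *\<^sub>R q + u *\<^sub>R r"
  shows "u = 0 \<or> u = 1"
proof (rule ccontr)
  assume "\<not> (u = 0 \<or> u = 1)"
  then have "p \<in> open_segment q r"
    unfolding in_segment using assms(4-7) by (intro conjI exI[of _ u]) auto
  then show False
    using assms by (auto simp: extreme_point_of_def)
qed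

text \<open>Extremality passes to the hull of the three points, and an extreme point of a hull
  belongs to the generating set. The triangle may be degenerate.\<close>

lemma extreme_point_of_triangle_vertex:
  assumes p: "p extreme_point_of S" and S: "convex S" "q \<in> S" "r \<in> S" "s \<in> S"
    and "0 \<le> u" "0 \<le> v" "0 \<le> w" "u + v + w = 1" "p = u *\<^sub>R q + v *\<^sub>R r + w *\<^sub>R s"
  shows "p = q \<or> p = r \<or> p = s"
proof -
  have "p \<in> convex hull {q, r, s}"
    using assms unfolding convex_hull_3 by blast
  moreover have "convex hull {q, r, s} \<subseteq> S"
    using S by (intro hull_minimal) auto
  ultimately have "p extreme_point_of convex hull {q, r, s}"
    using p by (auto simp: extreme_point_of_def)
  from extreme_point_of_convex_hull[OF this] show ?thesis
    by simp
qed

text \<open>An involution carries a segment through \<open>f p\<close> back to one through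
  \<open>p\<close>. It serves for the two symmetries of the ball, transposition and
  negation.\<close>

lemma extreme_point_of_linear_involution:
  assumes f: "linear f" "\<And>x. f (f x) = x" "f ` S \<subseteq> S" and p: "p extreme_point_of S"
  shows "f p extreme_point_of S"
  unfolding extreme_point_of_def
proof (intro conjI ballI notI)
  show "f p \<in> S"
    using f p by (auto simp: extreme_point_of_def)
  fix q r assume qr: "q \<in> S" "r \<in> S" "f p \<in> open_segment q r"
  then obtain u where u: "q \<noteq> r" "0 < u" "u < 1" "f p = (1 - u) *\<^sub>R q + u *\<^sub>R r"
    by (auto simp: in_segment)
  have "p = (1 - u) *\<^sub>R f q + u *\<^sub>R f r"
    using f(2)[of p] u(4) by (simp add: linear_add[OF f(1)] linear_scale[OF f(1)])
  moreover have "f q \<noteq> f r"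
    using u(1) f(2) by metis
  ultimately have "p \<in> open_segment (f q) (f r)"
    using u by (auto simp: in_segment)
  then show False
    using p qr f(3) by (auto simp: extreme_point_of_def)
qed

section \<open>Symmetries of the ball\<close>

definition transpose_form :: "real \<times> real \<times> real \<Rightarrow> real \<times> real \<times> real" where
  "transpose_form = (\<lambda>(a, b, c). (c, b, a))"

lemma transpose_form_simp [simp]: "transpose_form (a, b, c) = (c, b, a)"
  by (simp add: transpose_form_def)

text \<open>Transposition is the reflection in the line x = y, which maps \<open>Oct\<close> to
  itself.\<close>

lemma qform_transpose: "qform (transpose_form p) x y = qform p y x"
  by (cases p) (simp add: qform_eq)

lemma transpose_form_ball_Oct: "p \<in> ball_Oct \<Longrightarrow> transpose_form p \<in> ball_Oct"
  by (auto simp: mem_ball_Oct qform_transpose mem_Oct)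

lemma uminus_ball_Oct: "p \<in> ball_Oct \<Longrightarrow> - p \<in> ball_Oct"
  by (simp add: mem_ball_Oct qform_minus)

lemma extreme_ball_Oct_transpose:
  assumes "p extreme_point_of ball_Oct"
  shows "transpose_form p extreme_point_of ball_Oct"
proof (rule extreme_point_of_linear_involution[OF _ _ _ assms])
  show "linear transpose_form"
    by (rule linearI) (auto simp: transpose_form_def)
  show "transpose_form ` ball_Oct \<subseteq> ball_Oct"
    using transpose_form_ball_Oct by blast
qed (simp add: transpose_form_def split: prod.splits)

lemma extreme_ball_Oct_uminus:
  assumes "p extreme_point_of ball_Oct"
  shows "- p extreme_point_of ball_Oct"
proof (rule extreme_point_of_linear_involution[OF _ _ _ assms])
  show "uminus ` ball_Oct \<subseteq> ball_Oct"
    using uminus_ball_Oct by blast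
qed (auto simp: module_hom_uminus intro: linear_uminus)

section \<open>Quadratic functions on an interval\<close>

lemma nonneg_of_small_multiples:
  fixes A M :: real
  assumes "\<And>l. 0 < l \<Longrightarrow> l \<le> 1 \<Longrightarrow> 0 \<le> A + l * M"
  shows "0 \<le> A"
proof (rule ccontr)
  assume "\<not> 0 \<le> A"
  \<comment> \<open>For negative \<open>A\<close> this choice keeps \<open>l * \<bar>M\<bar>\<close>
    below \<open>- A / 2\<close>.\<close>
  define l where "l = min 1 (- A / (2 * (\<bar>M\<bar> + 1)))"
  have l: "0 < l" "l \<le> 1" "l \<le> - A / (2 * (\<bar>M\<bar> + 1))"
    using \<open>\<not> 0 \<le> A\<close> by (auto simp: l_def intro!: divide_neg_pos)
  then have "l * (2 * (\<bar>M\<bar> + 1)) \<le> - A"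
    by (subst (asm) pos_le_divide_eq) auto
  then have l_M: "2 * (l * \<bar>M\<bar>) + 2 * l \<le> - A"
    by (simp add: algebra_simps)
  have "l * M \<le> l * \<bar>M\<bar>"
    using l by (intro mult_left_mono) auto
  then show False
    using assms[OF l(1,2)] l l_M \<open>\<not> 0 \<le> A\<close> by linarith
qed

text \<open>At a zero of a nonnegative function the derivative towards any point \<open>e\<close> of
  the interval is nonnegative. The zero may be an endpoint, which is what contact at a vertex
  requires.\<close>

lemma one_sided_derivative_nonneg:
  fixes A B C :: real
  assumes nonneg: "\<And>x. u \<le> x \<Longrightarrow> x \<le> v \<Longrightarrow> 0 \<le> A * x\<^sup>2 + B * x + C"
    and x0: "u \<le> x0" "x0 \<le> v" "A * x0\<^sup>2 + B * x0 + C = 0"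
    and e: "u \<le> e" "e \<le> v"
  shows "0 \<le> (e - x0) * (2 * A * x0 + B)"
proof (rule nonneg_of_small_multiples)
  fix l :: real assume l: "0 < l" "l \<le> 1"
  have "x0 + l * (e - x0) = (1 - l) * x0 + l * e"
    by (simp add: algebra_simps)
  moreover have "(1 - l) * u + l * u \<le> (1 - l) * x0 + l * e" "(1 - l) * x0 + l * e \<le> (1 - l) * v + l * v"
    using l x0 e by (intro add_mono mult_left_mono; simp)+
  ultimately have "0 \<le> A * (x0 + l * (e - x0))\<^sup>2 + B * (x0 + l * (e - x0)) + C"
    by (intro nonneg) (auto simp: algebra_simps)
  also have "\<dots> = (A * x0\<^sup>2 + B * x0 + C) + l * ((e - x0) * (2 * A * x0 + B) + l * (A * (e - x0)\<^sup>2))"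
    by (simp add: power2_eq_square algebra_simps)
  finally show "0 \<le> (e - x0) * (2 * A * x0 + B) + l * (A * (e - x0)\<^sup>2)"
    using x0(3) l by (simp add: zero_le_mult_iff)
qed

text \<open>At an interior zero the derivatives in both directions are nonnegative, so the zero is
  double and the quadratic is \<open>A * (x - x0)^2\<close>.\<close>

lemma nonneg_quadratic_interior_zero:
  fixes A B C :: real
  assumes nonneg: "\<And>x. u \<le> x \<Longrightarrow> x \<le> v \<Longrightarrow> 0 \<le> A * x\<^sup>2 + B * x + C"
    and x0: "u < x0" "x0 < v" "A * x0\<^sup>2 + B * x0 + C = 0"
  shows "0 \<le> A" "B = - 2 * A * x0" "C = A * x0\<^sup>2"
proof -
  have "0 \<le> (u - x0) * (2 * A * x0 + B)" "0 \<le> (v - x0) * (2 * A * x0 + B)"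
    using one_sided_derivative_nonneg[OF nonneg _ _ x0(3)] x0 by auto
  then show B: "B = - 2 * A * x0"
    using x0 by (auto simp: zero_le_mult_iff)
  then show C: "C = A * x0\<^sup>2"
    using x0(3) by (simp add: power2_eq_square algebra_simps)
  have "0 \<le> A * u\<^sup>2 + B * u + C"
    using x0 by (intro nonneg) auto
  also have "\<dots> = A * (u - x0)\<^sup>2"
    by (simp add: B C power2_eq_square algebra_simps)
  finally show "0 \<le> A"
    using x0 by (simp add: zero_le_mult_iff)
qed

text \<open>The bound makes the affine function vanish to second order at \<open>x0\<close>.
  One-sided derivatives, taken for both signs, also cover \<open>x0\<close> at an end of the
  interval.\<close>

lemma affine_zero_of_quadratic_bound:
  fixes B C k :: real
  assumes bound: "\<And>x. u \<le> x \<Longrightarrow> x \<le> v \<Longrightarrow> \<bar>B * x + C\<bar> \<le> k * (x - x0)\<^sup>2"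
    and x0: "u \<le> x0" "x0 \<le> v" "u < v"
  shows "B = 0" "C = 0"
proof -
  have zero: "B * x0 + C = 0"
    using bound[OF x0(1,2)] by simp
  obtain e where e: "u \<le> e" "e \<le> v" "e \<noteq> x0"
    using x0 by (metis less_imp_le order_refl order_less_irrefl)
  \<comment> \<open>The quadratic \<open>k * (x - x0)^2 + s * (B * x + C)\<close> is nonnegative,
    vanishes at \<open>x0\<close> and has derivative \<open>s * B\<close> there.\<close>
  have "0 \<le> (e - x0) * (2 * k * x0 + (s * B - 2 * k * x0))"
    if "s = 1 \<or> s = - 1" for s
  proof (rule one_sided_derivative_nonneg[OF _ x0(1,2) _ e(1,2)])
    have "k * x0\<^sup>2 + (s * B - 2 * k * x0) * x0 + (s * C + k * x0\<^sup>2) = s * (B * x0 + C)"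
      by (simp add: power2_eq_square algebra_simps)
    then show "k * x0\<^sup>2 + (s * B - 2 * k * x0) * x0 + (s * C + k * x0\<^sup>2) = 0"
      by (simp add: zero)
    fix x assume "u \<le> x" "x \<le> v"
    have "k * x\<^sup>2 + (s * B - 2 * k * x0) * x + (s * C + k * x0\<^sup>2) = k * (x - x0)\<^sup>2 + s * (B * x + C)"
      by (simp add: power2_eq_square algebra_simps)
    then show "0 \<le> k * x\<^sup>2 + (s * B - 2 * k * x0) * x + (s * C + k * x0\<^sup>2)"
      using bound[OF \<open>u \<le> x\<close> \<open>x \<le> v\<close>] that by auto
  qed
  from this[of 1] this[of "- 1"] have "(e - x0) * B = 0"
    by simp
  then show "B = 0"
    using e(3) by simp
  then show "C = 0"
    using zero by simp
qed

section \<open>The points on the list\<close>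

text \<open>The form is \<open>x^2 - k * (y - y0 * x)^2\<close>, a difference of two numbers between
  0 and 1. It touches 1 at the point \<open>(1, y0)\<close>.\<close>

lemma x_edge_form_in_ball_Oct:
  assumes y0: "0 \<le> y0" "y0 \<le> tau" and k: "0 \<le> k" "k \<le> 1"
  shows "(1 - k * y0\<^sup>2, 2 * k * y0, - k) \<in> ball_Oct"
  unfolding mem_ball_Oct
proof (intro allI impI)
  fix x y assume xy: "(x, y) \<in> Oct"
  have eq: "qform (1 - k * y0\<^sup>2, 2 * k * y0, - k) x y = x\<^sup>2 - k * (y - y0 * x)\<^sup>2"
    by (simp add: qform_eq power2_eq_square algebra_simps)
  have "y0 * x \<le> 1 * 1"
    using y0 tau_bounds xy by (intro mult_mono) (auto simp: mem_Oct)
  moreover have "0 \<le> y0 * x"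
    using y0 xy by (auto simp: mem_Oct)
  ultimately have "\<bar>y - y0 * x\<bar> \<le> 1"
    using xy by (auto simp: mem_Oct abs_le_iff)
  then have "(y - y0 * x)\<^sup>2 \<le> 1"
    by (simp add: abs_square_le_1)
  then have "k * (y - y0 * x)\<^sup>2 \<le> 1 * 1"
    using k by (intro mult_mono) auto
  moreover have "0 \<le> k * (y - y0 * x)\<^sup>2"
    using k by simp
  moreover have "x\<^sup>2 \<le> 1" "0 \<le> x\<^sup>2"
    using xy by (auto simp: mem_Oct abs_square_le_1)
  ultimately show "\<bar>qform (1 - k * y0\<^sup>2, 2 * k * y0, - k) x y\<bar> \<le> 1"
    unfolding eq abs_le_iff by linarith
qed

lemma half_square_sum_le_1:
  assumes "(x, y) \<in> Oct"
  shows "(x + y)\<^sup>2 / 2 \<le> 1"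
proof -
  have "(x + y)\<^sup>2 \<le> (1 + tau)\<^sup>2"
    using assms by (intro power_mono) (auto simp: mem_Oct)
  also have "\<dots> = 2"
    by (simp flip: sqrt2_eq)
  finally show ?thesis
    by simp
qed

text \<open>Above, the form is \<open>(x + y)^2 / 2\<close> minus a square. Below, adding
  \<open>(x - y)^2\<close> leaves only nonnegative terms, because \<open>tau\<close> exceeds
  1/3.\<close>

lemma diagonal_form_in_ball_Oct:
  assumes r: "tau \<le> r" "r \<le> 1"
  shows "(- 1, 1 + 3 * r, 1/2 - 3/2 * r\<^sup>2) \<in> ball_Oct"
  unfolding mem_ball_Oct
proof (intro allI impI)
  fix x y assume xy: "(x, y) \<in> Oct"
  let ?P = "qform (- 1, 1 + 3 * r, 1/2 - 3/2 * r\<^sup>2) x y"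
  have eq: "?P = (x + y)\<^sup>2 / 2 - 3/2 * (x - r * y)\<^sup>2"
    by (simp add: qform_eq power2_eq_square algebra_simps)
  then have "?P \<le> (x + y)\<^sup>2 / 2"
    by simp
  then have upper: "?P \<le> 1"
    using half_square_sum_le_1[OF xy] by linarith
  have "r\<^sup>2 \<le> 1"
    using r tau_bounds by (simp add: abs_square_le_1)
  then have "0 \<le> (3 * r - 1) * (x * y) + 3/2 * (1 - r\<^sup>2) * y\<^sup>2"
    using r tau_bounds xy by (intro add_nonneg_nonneg mult_nonneg_nonneg) (auto simp: mem_Oct)
  also have "\<dots> = ?P + (x - y)\<^sup>2"
    by (simp add: qform_eq power2_eq_square field_simps)
  finally have "- (x - y)\<^sup>2 \<le> ?P"
    by simp
  moreover have "(x - y)\<^sup>2 \<le> 1"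
    using xy by (simp add: mem_Oct abs_square_le_1 abs_le_iff)
  ultimately show "\<bar>?P\<bar> \<le> 1"
    using upper by (simp add: abs_le_iff)
qed

lemma p1_in_ball_Oct: "p1 \<in> ball_Oct"
  using x_edge_form_in_ball_Oct[of 0 0] tau_bounds by (simp add: p1_def)

lemma p2_in_ball_Oct: "p2 \<in> ball_Oct"
  unfolding mem_ball_Oct
proof (intro allI impI)
  fix x y assume xy: "(x, y) \<in> Oct"
  have "qform p2 x y = (x + y)\<^sup>2 / 2"
    by (simp add: p2_def qform_eq power2_eq_square algebra_simps)
  then show "\<bar>qform p2 x y\<bar> \<le> 1"
    using half_square_sum_le_1[OF xy] zero_le_power2[of "x + y"] by linarith
qed

lemma p3_in_ball_Oct: "p3 \<in> ball_Oct"
  unfolding mem_ball_Oct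
proof (intro allI impI)
  fix x y assume xy: "(x, y) \<in> Oct"
  have eq: "qform p3 x y = x\<^sup>2 + y\<^sup>2 - tau * x * y"
    by (simp add: p3_def qform_eq)
  have tau: "tau * tau = 1 - 2 * tau"
    using tau_squared by (simp add: power2_eq_square)
  have "tau * (x * y) \<le> 2 * (x * y)"
    using tau_bounds xy by (intro mult_right_mono) (auto simp: mem_Oct)
  moreover have "0 \<le> (x - y)\<^sup>2"
    by simp
  ultimately have lower: "0 \<le> qform p3 x y"
    unfolding eq by (simp add: power2_eq_square algebra_simps)
  \<comment> \<open>The rays through the vertices \<open>(1, tau)\<close> and
    \<open>(tau, 1)\<close> cut the quadrant into three sectors. In each the form is at most the
    form of the edge it meets: \<open>x^2\<close>, \<open>y^2\<close> or
    \<open>(x + y)^2 / 2\<close>.\<close>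
  consider "y \<le> tau * x" | "x \<le> tau * y" | "0 \<le> (y - tau * x) * (x - tau * y)"
    by (smt (verit) mult_nonneg_nonneg)
  then have "qform p3 x y \<le> 1"
  proof cases
    case 1
    then have "y * (y - tau * x) \<le> 0" "x\<^sup>2 \<le> 1"
      using xy by (auto simp: mem_Oct mult_le_0_iff abs_square_le_1)
    then show ?thesis
      unfolding eq by (simp add: power2_eq_square algebra_simps)
  next
    case 2
    then have "x * (x - tau * y) \<le> 0" "y\<^sup>2 \<le> 1"
      using xy by (auto simp: mem_Oct mult_le_0_iff abs_square_le_1)
    then show ?thesis
      unfolding eq by (simp add: power2_eq_square algebra_simps)
  next
    case 3
    have "(1 + tau * tau) * (x * y) - tau * (x\<^sup>2 + y\<^sup>2) = (y - tau * x) * (x - tau * y)"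
      by (simp add: power2_eq_square algebra_simps)
    then have "0 \<le> (2 - 2 * tau) * (x * y) - tau * (x\<^sup>2 + y\<^sup>2)"
      using 3 tau by (simp add: algebra_simps)
    \<comment> \<open>With the factor \<open>2 + tau\<close> the expression becomes
      \<open>(x + y)^2 - 2 * P\<close>, up to a multiple of
      \<open>tau * tau + 2 * tau - 1 = 0\<close>.\<close>
    then have "0 \<le> (2 + tau) * ((2 - 2 * tau) * (x * y) - tau * (x\<^sup>2 + y\<^sup>2))"
      using tau_bounds by simp
    also have "\<dots> = (x + y)\<^sup>2 - 2 * qform p3 x y + (tau * tau + 2 * tau - 1) * (- 2 * (x * y) - x\<^sup>2 - y\<^sup>2)"
      unfolding eq by (simp add: power2_eq_square algebra_simps)
    finally show ?thesis
      using half_square_sum_le_1[OF xy] tau by simp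
  qed
  then show "\<bar>qform p3 x y\<bar> \<le> 1"
    using lower by simp
qed

section \<open>Extremality of the listed points\<close>

lemma qform_perturbation_bound:
  assumes "p + d \<in> ball_Oct" "p - d \<in> ball_Oct" "(x, y) \<in> Oct"
  shows "\<bar>qform d x y\<bar> \<le> 1 - \<bar>qform p x y\<bar>"
  using ball_OctD[OF assms(1,3)] ball_OctD[OF assms(2,3)]
  by (simp add: qform_add qform_diff abs_le_iff abs_if)

text \<open>The form equals 1 along the whole edge x = 1, so a perturbation vanishes there; three
  zeros of a quadratic in y suffice.\<close>

lemma extreme_p1: "p1 extreme_point_of ball_Oct"
proof (rule extreme_point_ofI_perturb[OF convex_ball_Oct p1_in_ball_Oct])
  fix d assume d: "p1 + d \<in> ball_Oct" "p1 - d \<in> ball_Oct"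
  obtain a b c where abc: "d = (a, b, c)"
    by (cases d)
  have zero: "a + b * y + c * y\<^sup>2 = 0" if "0 \<le> y" "y \<le> tau" for y
    using qform_perturbation_bound[OF d, of 1 y] that tau_bounds
    by (simp add: mem_Oct abc p1_def qform_eq)
  have "a = 0" "a + b * tau + c * tau\<^sup>2 = 0" "a + b * (tau/2) + c * (tau/2)\<^sup>2 = 0"
    using zero[of 0] zero[of tau] zero[of "tau/2"] tau_bounds by auto
  then have "a = 0" "tau * (b + c * tau) = 0" "tau * (b + c * (tau/2)) = 0"
    by (auto simp: power2_eq_square algebra_simps)
  then have "a = 0" "b + c * tau = 0" "b + c * (tau/2) = 0"
    using tau_bounds by auto
  then have "a = 0" "b + c * tau = 0" "c * tau = 0"
    by linarith+
  then show "d = 0"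
    using tau_bounds by (simp add: abc zero_prod_def)
qed

lemma extreme_p0: "p0 extreme_point_of ball_Oct"
  using extreme_ball_Oct_transpose[OF extreme_p1] by (simp add: p0_def p1_def)

text \<open>The form equals 1 along the whole diagonal edge; the two vertices and the midpoint
  determine the perturbation.\<close>

lemma extreme_p2: "p2 extreme_point_of ball_Oct"
proof (rule extreme_point_ofI_perturb[OF convex_ball_Oct p2_in_ball_Oct])
  fix d assume d: "p2 + d \<in> ball_Oct" "p2 - d \<in> ball_Oct"
  obtain a b c where abc: "d = (a, b, c)"
    by (cases d)
  have tau: "tau * tau = 1 - 2 * tau"
    using tau_squared by (simp add: power2_eq_square)
  have zero: "a * x\<^sup>2 + b * x * y + c * y\<^sup>2 = 0" if "0 \<le> x" "x \<le> 1" "0 \<le> y" "y \<le> 1" "x + y = 1 + tau" for x y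
  proof -
    have "qform p2 x y = (x + y)\<^sup>2 / 2"
      by (simp add: p2_def qform_eq power2_eq_square algebra_simps)
    also have "\<dots> = 1"
      unfolding that(5) by (simp flip: sqrt2_eq)
    finally show ?thesis
      using qform_perturbation_bound[OF d, of x y] that by (simp add: mem_Oct abc qform_eq)
  qed
  have e1: "a + b * tau + c * tau\<^sup>2 = 0" and e2: "a * tau\<^sup>2 + b * tau + c = 0"
    using zero[of 1 tau] zero[of tau 1] tau_bounds by auto
  define m where "m = (1 + tau) / 2"
  have "m\<^sup>2 * (a + b + c) = a * m\<^sup>2 + b * m * m + c * m\<^sup>2"
    by (simp add: power2_eq_square algebra_simps)
  also have "\<dots> = 0"
    using tau_bounds by (intro zero) (auto simp: m_def)
  finally have e3: "a + b + c = 0"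
    using tau_bounds by (simp add: m_def)
  have "(a - c) * (1 - tau\<^sup>2) = 0"
    using e1 e2 by (simp add: algebra_simps)
  then have "a = c"
    using tau_bounds by (simp add: tau_squared)
  then have b: "b = - 2 * a"
    using e3 by simp
  have "a * (2 - 4 * tau) = 0"
    using e1 \<open>a = c\<close> unfolding b tau_squared by (simp add: algebra_simps)
  then have "a = 0"
    using tau_bounds by simp
  then show "d = 0"
    using \<open>a = c\<close> e3 by (simp add: abc zero_prod_def)
qed

text \<open>Contact at \<open>(1, 0)\<close>, \<open>(0, 1)\<close> and \<open>(1, tau)\<close>
  gives three independent linear conditions on the perturbation.\<close>

lemma extreme_p3: "p3 extreme_point_of ball_Oct"
proof (rule extreme_point_ofI_perturb[OF convex_ball_Oct p3_in_ball_Oct])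
  fix d assume d: "p3 + d \<in> ball_Oct" "p3 - d \<in> ball_Oct"
  obtain a b c where abc: "d = (a, b, c)"
    by (cases d)
  have "a = 0" "c = 0"
    using qform_perturbation_bound[OF d, of 1 0] qform_perturbation_bound[OF d, of 0 1] tau_bounds
    by (simp_all add: mem_Oct abc p3_def qform_eq)
  moreover from this have "b * tau = 0"
    using qform_perturbation_bound[OF d, of 1 tau] tau_bounds
    by (simp add: mem_Oct abc p3_def qform_eq power2_eq_square)
  ultimately show "d = 0"
    using tau_bounds by (simp add: abc zero_prod_def)
qed

text \<open>The value -1 at \<open>(0, 1)\<close> removes \<open>c\<close>. The rest of the
  perturbation is affine on the edge x = 1 and bounded by \<open>(y - y0)^2\<close>.\<close>

lemma extreme_x_edge_form:
  assumes y0: "0 \<le> y0" "y0 \<le> tau"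
  shows "(1 - y0\<^sup>2, 2 * y0, - 1) extreme_point_of ball_Oct" (is "?p extreme_point_of _")
proof (rule extreme_point_ofI_perturb[OF convex_ball_Oct])
  show "?p \<in> ball_Oct"
    using x_edge_form_in_ball_Oct[OF y0, of 1] by simp
  fix d assume d: "?p + d \<in> ball_Oct" "?p - d \<in> ball_Oct"
  obtain a b c where abc: "d = (a, b, c)"
    by (cases d)
  have c: "c = 0"
    using qform_perturbation_bound[OF d, of 0 1] tau_bounds by (simp add: mem_Oct abc qform_eq)
  have "\<bar>b * y + a\<bar> \<le> 1 * (y - y0)\<^sup>2" if y: "0 \<le> y" "y \<le> tau" for y
  proof -
    have "qform ?p 1 y = 1 - (y - y0)\<^sup>2"
      by (simp add: qform_eq power2_eq_square algebra_simps)
    then show ?thesis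
      using qform_perturbation_bound[OF d, of 1 y] y tau_bounds
      by (simp add: mem_Oct abc c qform_eq abs_if add.commute split: if_splits)
  qed
  then have "b = 0" "a = 0"
    using affine_zero_of_quadratic_bound[of 0 tau b a 1 y0] y0 tau_bounds by auto
  then show "d = 0"
    by (simp add: abc c zero_prod_def)
qed

text \<open>The value -1 at \<open>(1, 0)\<close> removes \<open>a\<close>. On the diagonal edge the
  perturbation is then y times an affine function, and it is controlled by the double contact at
  height \<open>y0\<close>.\<close>

lemma extreme_diagonal_form:
  assumes r: "tau \<le> r" "r \<le> 1"
  shows "(- 1, 1 + 3 * r, 1/2 - 3/2 * r\<^sup>2) extreme_point_of ball_Oct" (is "?p extreme_point_of _")
proof (rule extreme_point_ofI_perturb[OF convex_ball_Oct diagonal_form_in_ball_Oct[OF r]])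
  fix d assume d: "?p + d \<in> ball_Oct" "?p - d \<in> ball_Oct"
  obtain a b c where abc: "d = (a, b, c)"
    by (cases d)
  have a: "a = 0"
    using qform_perturbation_bound[OF d, of 1 0] tau_bounds by (simp add: mem_Oct abc qform_eq)
  define h where "h = 1 + tau"
  have h: "h > 0" "h * h = 2"
    using tau_bounds by (simp_all add: h_def flip: sqrt2_eq)
  \<comment> \<open>The height at which the ray \<open>x = r * y\<close> meets the diagonal
    edge.\<close>
  define y0 where "y0 = h / (1 + r)"
  have y0: "y0 * (1 + r) = h"
    using r tau_bounds by (simp add: y0_def)
  have "y0 \<le> 1"
    using r tau_bounds by (simp add: y0_def h_def)
  have "tau * (1 + r) \<le> 1 + tau"
    using r tau_bounds mult_mono[of tau 1 r 1] by (simp add: algebra_simps)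
  then have "tau \<le> y0"
    using r tau_bounds by (simp add: y0_def h_def pos_le_divide_eq)
  \<comment> \<open>Division by y costs at most the factor \<open>1 / tau\<close>; the constant 3/2
    is relaxed to 3.\<close>
  have "\<bar>(c - b) * y + b * h\<bar> \<le> 3 / tau * (1 + r)\<^sup>2 * (y - y0)\<^sup>2" if y: "tau \<le> y" "y \<le> 1" for y
  proof -
    have Oct: "(h - y, y) \<in> Oct"
      using y tau_bounds by (auto simp: mem_Oct h_def)
    have "h - y - r * y = - ((1 + r) * (y - y0))"
      using y0 by (simp add: algebra_simps)
    then have sq: "(h - y - r * y)\<^sup>2 = (1 + r)\<^sup>2 * (y - y0)\<^sup>2"
      by (simp add: power_mult_distrib)
    have "qform ?p (h - y) y = (h - y + y)\<^sup>2 / 2 - 3/2 * (h - y - r * y)\<^sup>2"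
      by (simp add: qform_eq power2_eq_square algebra_simps)
    also have "\<dots> = 1 - 3/2 * ((1 + r)\<^sup>2 * (y - y0)\<^sup>2)"
      unfolding sq using h by (simp add: power2_eq_square)
    finally have "\<bar>qform d (h - y) y\<bar> \<le> 3/2 * ((1 + r)\<^sup>2 * (y - y0)\<^sup>2)"
      using qform_perturbation_bound[OF d Oct] by linarith
    also have "qform d (h - y) y = y * ((c - b) * y + b * h)"
      by (simp add: abc a qform_eq power2_eq_square algebra_simps)
    finally have "y * \<bar>(c - b) * y + b * h\<bar> \<le> 3/2 * ((1 + r)\<^sup>2 * (y - y0)\<^sup>2)"
      using y tau_bounds by (simp add: abs_mult)
    moreover have "tau * \<bar>(c - b) * y + b * h\<bar> \<le> y * \<bar>(c - b) * y + b * h\<bar>"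
      using y by (intro mult_right_mono) auto
    moreover have "0 \<le> (1 + r)\<^sup>2 * (y - y0)\<^sup>2"
      by simp
    ultimately have "tau * \<bar>(c - b) * y + b * h\<bar> \<le> 3 * ((1 + r)\<^sup>2 * (y - y0)\<^sup>2)"
      by linarith
    then show ?thesis
      using tau_bounds by (simp add: field_simps)
  qed
  from affine_zero_of_quadratic_bound[OF this \<open>tau \<le> y0\<close> \<open>y0 \<le> 1\<close>] tau_bounds
  have "c - b = 0" "b * h = 0"
    by auto
  then show "d = 0"
    using h by (simp add: abc a zero_prod_def)
qed

section \<open>The curves parametrized by their contact points\<close>

lemma Gamma4_iff: "p \<in> Gamma4 \<longleftrightarrow> (\<exists>y0. 0 \<le> y0 \<and> y0 \<le> tau \<and> p = (1 - y0\<^sup>2, 2 * y0, - 1))"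
proof
  assume "p \<in> Gamma4"
  then obtain t where t: "2 * tau \<le> t" "t \<le> 1" "p = (t, 2 * sqrt (1 - t), - 1)"
    by (auto simp: Gamma4_def)
  then have "sqrt (1 - t) \<le> tau"
    using tau_bounds by (intro real_le_lsqrt) (auto simp: tau_squared)
  then show "\<exists>y0. 0 \<le> y0 \<and> y0 \<le> tau \<and> p = (1 - y0\<^sup>2, 2 * y0, - 1)"
    \<comment> \<open>The new parameter is the height of the contact point on the edge x =
      1.\<close>
    using t by (intro exI[of _ "sqrt (1 - t)"]) auto
next
  assume "\<exists>y0. 0 \<le> y0 \<and> y0 \<le> tau \<and> p = (1 - y0\<^sup>2, 2 * y0, - 1)"
  then obtain y0 where y0: "0 \<le> y0" "y0 \<le> tau" "p = (1 - y0\<^sup>2, 2 * y0, - 1)"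
    by blast
  then have "y0\<^sup>2 \<le> tau\<^sup>2"
    by (intro power_mono) auto
  then show "p \<in> Gamma4"
    using y0 unfolding Gamma4_def by (auto intro!: exI[of _ "1 - y0\<^sup>2"] simp: tau_squared)
qed

text \<open>The parameter \<open>r\<close> is the ratio x / y at the contact point on the diagonal
  edge: \<open>t = sigma\<close> corresponds to \<open>r = tau\<close>, and \<open>t = -1\<close> to
  \<open>r = 1\<close>.\<close>

lemma Gamma2_iff:
  "p \<in> Gamma2 \<longleftrightarrow> (\<exists>r. tau \<le> r \<and> r \<le> 1 \<and> p = (- 1, 1 + 3 * r, 1/2 - 3/2 * r\<^sup>2))"
proof
  assume "p \<in> Gamma2"
  then obtain t where t: "- 1 \<le> t" "t \<le> sigma" "p = (- 1, 1 + sqrt (3 * (1 - 2 * t)), t)"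
    by (auto simp: Gamma2_def)
  define r where "r = sqrt (3 * (1 - 2 * t)) / 3"
  have "(3 * tau)\<^sup>2 \<le> 3 * (1 - 2 * t)"
    using t by (simp add: power_mult_distrib tau_squared sigma_tau)
  then have "3 * tau \<le> sqrt (3 * (1 - 2 * t))"
    by (rule real_le_rsqrt)
  moreover have "sqrt (3 * (1 - 2 * t)) \<le> 3"
    using t by (intro real_le_lsqrt) auto
  moreover have "r\<^sup>2 = (1 - 2 * t) / 3"
    using t sigma_tau tau_bounds by (simp add: r_def power_divide)
  ultimately show "\<exists>r. tau \<le> r \<and> r \<le> 1 \<and> p = (- 1, 1 + 3 * r, 1/2 - 3/2 * r\<^sup>2)"
    using t(3) by (intro exI[of _ r]) (auto simp: r_def)
next
  assume "\<exists>r. tau \<le> r \<and> r \<le> 1 \<and> p = (- 1, 1 + 3 * r, 1/2 - 3/2 * r\<^sup>2)"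
  then obtain r where r: "tau \<le> r" "r \<le> 1" "p = (- 1, 1 + 3 * r, 1/2 - 3/2 * r\<^sup>2)"
    by blast
  have "tau\<^sup>2 \<le> r\<^sup>2"
    using r tau_bounds by (intro power_mono) auto
  then have "1/2 - 3/2 * r\<^sup>2 \<le> sigma"
    by (simp add: tau_squared sigma_tau)
  moreover have "r\<^sup>2 \<le> 1"
    using r tau_bounds by (simp add: abs_square_le_1)
  moreover have "sqrt (3 * (1 - 2 * (1/2 - 3/2 * r\<^sup>2))) = 3 * r"
    using r tau_bounds by (intro real_sqrt_unique) (auto simp: power_mult_distrib)
  ultimately show "p \<in> Gamma2"
    using r unfolding Gamma2_def by (auto intro!: exI[of _ "1/2 - 3/2 * r\<^sup>2"])
qed

lemma Gamma1_eq: "Gamma1 = transpose_form ` Gamma4"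
  unfolding Gamma1_def Gamma4_def by (force simp: image_iff)

lemma Gamma3_eq: "Gamma3 = transpose_form ` Gamma2"
  unfolding Gamma3_def Gamma2_def by (force simp: image_iff)

text \<open>Negated curves and points are left out: this is the set in which extreme points with
  maximal middle coefficient are located.\<close>

definition listed_points :: "(real \<times> real \<times> real) set" where
  "listed_points = Gamma1 \<union> Gamma2 \<union> Gamma3 \<union> Gamma4 \<union> {p0, p1, p2, p3}"

lemma transpose_form_listed_points:
  assumes "p \<in> listed_points"
  shows "transpose_form p \<in> listed_points"
proof -
  have "transpose_form (transpose_form q) = q" for q
    by (cases q) simp
  moreover have "transpose_form p0 = p1" "transpose_form p1 = p0" "transpose_form p2 = p2" "transpose_form p3 = p3"
    by (simp_all add: p0_def p1_def p2_def p3_def)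
  ultimately show ?thesis
    using assms unfolding listed_points_def Gamma1_eq Gamma3_eq by auto
qed

lemma listed_points_extreme:
  assumes "p \<in> listed_points"
  shows "p extreme_point_of ball_Oct"
proof -
  have "q extreme_point_of ball_Oct" if "q \<in> Gamma2 \<or> q \<in> Gamma4" for q :: "real \<times> real \<times> real"
    using that extreme_x_edge_form extreme_diagonal_form unfolding Gamma2_iff Gamma4_iff by blast
  then show ?thesis
    using assms extreme_p0 extreme_p1 extreme_p2 extreme_p3
    unfolding listed_points_def Gamma1_eq Gamma3_eq by (blast intro: extreme_ball_Oct_transpose)
qed

lemma listed_points_in_ball_Oct: "p \<in> listed_points \<Longrightarrow> p \<in> ball_Oct"
  using listed_points_extreme by (auto simp: extreme_point_of_def)

section \<open>Every extreme point is on the list\<close>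

text \<open>As \<open>k\<close> varies, \<open>p\<close> runs along the line from \<open>p1\<close>
  (at 0) to a point of \<open>Gamma4\<close> (at 1). The bound \<open>-1 \<le> c\<close> keeps it on
  the segment, so extremality leaves only the ends.\<close>

lemma extreme_x_edge_contact:
  assumes p: "p extreme_point_of ball_Oct" "p = (1 - k * y0\<^sup>2, 2 * k * y0, - k)"
    and k: "0 \<le> k" and y0: "0 \<le> y0" "y0 \<le> tau"
  shows "p \<in> listed_points"
proof -
  let ?q = "(1 - y0\<^sup>2, 2 * y0, - 1)"
  have q: "?q \<in> listed_points"
    using y0 Gamma4_iff[of ?q] by (auto simp: listed_points_def)
  have "p \<in> ball_Oct"
    using p(1) by (simp add: extreme_point_of_def)
  then have "k \<le> 1"
    using ball_Oct_coeff_bounds p(2) by fastforce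
  moreover have eq: "p = (1 - k) *\<^sub>R p1 + k *\<^sub>R ?q"
    by (simp add: p(2) p1_def algebra_simps)
  ultimately have "k = 0 \<or> k = 1"
    using k p1_in_ball_Oct listed_points_in_ball_Oct[OF q]
    by (intro extreme_point_of_segment_endpoint[OF p(1) _ _ _ _ _ eq]) (auto simp: p1_def)
  then show ?thesis
  proof
    assume "k = 0"
    then show ?thesis
      using p(2) by (simp add: listed_points_def p1_def)
  next
    assume "k = 1"
    then show ?thesis
      using p(2) q by simp
  qed
qed

text \<open>The form is \<open>(x + y)^2 / 2 - k * (x - r * y)^2\<close>, on the line from
  \<open>p2\<close> (\<open>k = 0\<close>) to a point of \<open>Gamma2\<close>
  (\<open>k = 3/2\<close>, where \<open>a = -1\<close>).\<close>

lemma extreme_diagonal_contact_aux: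
  assumes p: "p extreme_point_of ball_Oct" "p = (1/2 - k, 1 + 2 * k * r, 1/2 - k * r\<^sup>2)"
    and k: "0 \<le> k" and r: "tau \<le> r" "r \<le> 1"
  shows "p \<in> listed_points"
proof -
  let ?q = "(- 1, 1 + 3 * r, 1/2 - 3/2 * r\<^sup>2)"
  have q: "?q \<in> listed_points"
    using r Gamma2_iff[of ?q] by (auto simp: listed_points_def)
  have "p \<in> ball_Oct"
    using p(1) by (simp add: extreme_point_of_def)
  then have "2/3 * k \<le> 1"
    using ball_Oct_coeff_bounds p(2) by fastforce
  moreover have eq: "p = (1 - 2/3 * k) *\<^sub>R p2 + (2/3 * k) *\<^sub>R ?q"
    by (simp add: p(2) p2_def algebra_simps)
  ultimately have "2/3 * k = 0 \<or> 2/3 * k = 1"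
    using k p2_in_ball_Oct listed_points_in_ball_Oct[OF q]
    by (intro extreme_point_of_segment_endpoint[OF p(1) _ _ _ _ _ eq]) (auto simp: p2_def)
  then show ?thesis
  proof
    assume "2/3 * k = 0"
    then show ?thesis
      using p(2) by (simp add: listed_points_def p2_def)
  next
    assume "2/3 * k = 1"
    then have "k = 3/2"
      by simp
    with p(2) have "p = ?q"
      by simp
    then show ?thesis
      using q by blast
  qed
qed

text \<open>The form is \<open>(x + y)^2 / 2 - k * (y0 * x - x0 * y)^2\<close>. If
  \<open>x0 \<le> y0\<close>, rescaling by \<open>y0\<close> gives the ratio
  \<open>r = x0 / y0\<close>; otherwise transposition swaps the roles.\<close>

lemma extreme_diagonal_contact:
  assumes p: "p extreme_point_of ball_Oct" "p = (1/2 - k * y0\<^sup>2, 1 + 2 * k * x0 * y0, 1/2 - k * x0\<^sup>2)"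
    and k: "0 \<le> k" and xy: "tau \<le> x0" "x0 \<le> 1" "tau \<le> y0" "y0 \<le> 1"
  shows "p \<in> listed_points"
proof -
  have *: "q \<in> listed_points"
    if q: "q extreme_point_of ball_Oct" "q = (1/2 - k * v\<^sup>2, 1 + 2 * k * u * v, 1/2 - k * u\<^sup>2)"
      and uv: "tau \<le> u" "u \<le> v" "v \<le> 1" for q u v
  proof (rule extreme_diagonal_contact_aux[OF q(1)])
    show "q = (1/2 - k * v\<^sup>2, 1 + 2 * (k * v\<^sup>2) * (u / v), 1/2 - (k * v\<^sup>2) * (u / v)\<^sup>2)"
      using uv tau_bounds by (simp add: q(2) power2_eq_square)
    have "tau * v \<le> tau * 1"
      using uv tau_bounds by (intro mult_left_mono) auto
    also have "\<dots> \<le> u"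
      using uv by simp
    finally show "tau \<le> u / v"
      using uv tau_bounds by (simp add: pos_le_divide_eq)
  qed (use k uv tau_bounds in auto)
  show ?thesis
  proof (cases "x0 \<le> y0")
    case True
    then show ?thesis
      using *[OF p] xy by blast
  next
    case False
    have "transpose_form p \<in> listed_points"
      using extreme_ball_Oct_transpose[OF p(1)] False xy
      by (intro *[of _ x0 y0]) (auto simp: p(2))
    from transpose_form_listed_points[OF this] show ?thesis
      by (simp add: p(2))
  qed
qed

text \<open>The contact expresses \<open>b\<close> through \<open>a\<close> and \<open>c\<close>, so
  the problem is planar. Five inequalities put \<open>(a, c)\<close> in a pentagon with listed
  vertices, and extremality in a triangle of its triangulation leaves only a vertex.\<close>

lemma extreme_vertex_contact:
  assumes p: "(a, b, c) extreme_point_of ball_Oct" and contact: "qform (a, b, c) tau 1 = 1"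
  shows "(a, b, c) \<in> listed_points"
proof -
  have tau: "tau * tau = 1 - 2 * tau"
    using tau_squared by (simp add: power2_eq_square)
  have in_ball: "(a, b, c) \<in> ball_Oct"
    using p by (simp add: extreme_point_of_def)
  note bounds = ball_Oct_coeff_bounds[OF in_ball]
  have contact': "b * tau = 1 - c - a * (1 - 2 * tau)"
    using contact by (simp add: qform_eq tau_squared)

  \<comment> \<open>Derivative of \<open>1 - P\<close> at the vertex along the edge y = 1, towards
    \<open>(0, 1)\<close>.\<close>
  have "0 \<le> (0 - tau) * (2 * (- a) * tau + (- b))"
  proof (rule one_sided_derivative_nonneg[where u = 0 and v = tau and C = "1 - c"])
    show "0 \<le> - a * x\<^sup>2 + - b * x + (1 - c)" if "0 \<le> x" "x \<le> tau" for x
      using ball_OctD(1)[OF in_ball, of x 1] that tau_bounds by (simp add: mem_Oct qform_eq)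
    show "- a * tau\<^sup>2 + - b * tau + (1 - c) = 0"
      using contact by (simp add: qform_eq)
  qed (use tau_bounds in auto)
  also have "\<dots> = b * tau + 2 * a * (tau * tau)"
    by (simp add: algebra_simps)
  finally have edge1: "c \<le> 1 + a * (1 - 2 * tau)"
    unfolding tau contact' by (simp add: algebra_simps)

  \<comment> \<open>Derivative of \<open>1 - P\<close> at the vertex along the diagonal edge,
    parametrized by x, towards \<open>(1, tau)\<close>.\<close>
  have "0 \<le> (1 - tau) * (2 * (b - a - c) * tau + (2 * c - b) * (1 + tau))"
  proof (rule one_sided_derivative_nonneg[where u = tau and v = 1 and C = "1 - c * (1 + tau)\<^sup>2"])
    show "0 \<le> (b - a - c) * x\<^sup>2 + (2 * c - b) * (1 + tau) * x + (1 - c * (1 + tau)\<^sup>2)"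
      if "tau \<le> x" "x \<le> 1" for x
    proof -
      have "qform (a, b, c) x (1 + tau - x) \<le> 1"
        using that tau_bounds by (intro ball_OctD(1)[OF in_ball]) (auto simp: mem_Oct)
      then show ?thesis
        by (simp add: qform_eq power2_eq_square algebra_simps)
    qed
    show "(b - a - c) * tau\<^sup>2 + (2 * c - b) * (1 + tau) * tau + (1 - c * (1 + tau)\<^sup>2) = 0"
      using contact by (simp add: qform_eq power2_eq_square algebra_simps)
  qed (use tau_bounds in auto)
  then have "0 \<le> tau * (2 * (b - a - c) * tau + (2 * c - b) * (1 + tau))"
    using tau_bounds by (simp add: zero_le_mult_iff)
  also have "\<dots> = (b * tau) * (tau - 1) - 2 * a * (tau * tau) + 2 * c * tau"
    by (simp add: algebra_simps)
  also have "\<dots> = (1 + tau) * (c - tau - a * (1 - 2 * tau)) + (tau * tau - (1 - 2 * tau)) * (1 - 2 * a)"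
    unfolding contact' by (simp add: algebra_simps)
  finally have edge2: "tau + a * (1 - 2 * tau) \<le> c"
    using tau_bounds by (simp add: tau zero_le_mult_iff)

  have "a + b * tau + c * (1 - 2 * tau) \<le> 1"
    using ball_OctD(1)[OF in_ball, of 1 tau] tau_bounds by (simp add: mem_Oct qform_eq tau_squared)
  then have "(a - c) * (2 * tau) \<le> 0"
    unfolding contact' by (simp add: algebra_simps)
  then have edge3: "a \<le> c"
    using tau_bounds by (simp add: mult_le_0_iff)

  let ?A = "(- 1, 1 + 3 * tau, 3 * tau - 1)" and ?B = "(- 1, 2 * tau, 2 * tau)"
  have A: "?A \<in> listed_points"
    using Gamma2_iff[of ?A] tau_bounds
    by (auto simp: listed_points_def tau_squared field_simps intro!: exI[of _ tau])
  have "(2 * tau, 2 * tau, - 1) \<in> Gamma4"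
    unfolding Gamma4_iff using tau_bounds by (auto simp: tau_squared intro!: exI[of _ tau])
  then have B: "?B \<in> listed_points"
    by (force simp: listed_points_def Gamma1_eq image_iff)
  have P: "p0 \<in> listed_points" "p2 \<in> listed_points" "p3 \<in> listed_points"
    by (auto simp: listed_points_def)
  note vertex = extreme_point_of_triangle_vertex[OF p convex_ball_Oct
      listed_points_in_ball_Oct listed_points_in_ball_Oct listed_points_in_ball_Oct]
  (* The pentagon in the (a, c) plane has vertices A, B, p0, p3, p2 and is triangulated from p0. *)
  have b_eqI: "b = b'" if "b' * tau = 1 - c - a * (1 - 2 * tau)" for b'
    using that contact' tau_bounds mult_right_cancel[of tau b b'] by simp
  show ?thesis
  \<comment> \<open>The line \<open>a + c = 1\<close> is the diagonal from \<open>p0\<close> to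
    \<open>p2\<close>; beyond it lies the triangle \<open>p0\<close>, \<open>p3\<close>,
    \<open>p2\<close>.\<close>
  proof (cases "1 \<le> a + c")
    case True
    have "b = (a + c - 1) * (- tau) + 2 * (1 - c)"
    proof (rule b_eqI)
      have "((a + c - 1) * (- tau) + 2 * (1 - c)) * tau = - (a + c - 1) * (tau * tau) + 2 * (1 - c) * tau"
        by (simp add: algebra_simps)
      also have "\<dots> = 1 - c - a * (1 - 2 * tau)"
        unfolding tau by (simp add: algebra_simps)
      finally show "((a + c - 1) * (- tau) + 2 * (1 - c)) * tau = 1 - c - a * (1 - 2 * tau)" .
    qed
    then have eq: "(a, b, c) = (c - a) *\<^sub>R p0 + (a + c - 1) *\<^sub>R p3 + (2 * (1 - c)) *\<^sub>R p2"
      by (simp add: p0_def p2_def p3_def algebra_simps)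
    have "(a, b, c) = p0 \<or> (a, b, c) = p3 \<or> (a, b, c) = p2"
      using bounds edge3 True by (intro vertex[OF P(1) P(3) P(2) _ _ _ _ eq]) auto
    then show ?thesis
      using A B P by metis
  next
    case False
    \<comment> \<open>The barycentric coordinate of \<open>?A\<close>: \<open>1 - a - c\<close>
      vanishes at \<open>p0\<close> and \<open>p2\<close> and equals \<open>3 * (1 - tau)\<close> at
      \<open>?A\<close>.\<close>
    define u where "u = (1 - a - c) / (3 * (1 - tau))"
    have "0 \<le> u" "u * (3 * (1 - tau)) = 1 - a - c"
      using False tau_bounds by (simp_all add: u_def del: right_diff_distrib_numeral)
    then have u: "0 \<le> u" "3 * u * (1 - tau) = 1 - a - c"
      by (simp_all add: algebra_simps)
    show ?thesis
    \<comment> \<open>The coordinate of \<open>p2\<close> is \<open>2 * (a + u)\<close>; its sign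
      tells on which side of the diagonal from \<open>?A\<close> to \<open>p0\<close> the point
      lies.\<close>
    proof (cases "0 \<le> a + u")
      case True
      have "3 * u * (1 - tau) \<le> (1 - 2 * a) * (1 - tau)"
        using edge2 unfolding u(2) by (simp add: algebra_simps)
      then have w: "0 \<le> 1 - 2 * a - 3 * u"
        using tau_bounds by simp
      have c: "c = u * (3 * tau - 1) + (1 - 2 * a - 3 * u) + (a + u)"
        using u(2) by (simp add: algebra_simps)
      have "b = u * (1 + 3 * tau) + 2 * (a + u)"
      proof (rule b_eqI)
        have "(u * (1 + 3 * tau) + 2 * (a + u)) * tau = 3 * u * (tau * tau) + (3 * u + 2 * a) * tau"
          by (simp add: algebra_simps)
        also have "\<dots> = 1 - c - a * (1 - 2 * tau)"
          unfolding tau by (subst c) (simp add: algebra_simps)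
        finally show "(u * (1 + 3 * tau) + 2 * (a + u)) * tau = 1 - c - a * (1 - 2 * tau)" .
      qed
      then have eq: "(a, b, c) = u *\<^sub>R ?A + (1 - 2 * a - 3 * u) *\<^sub>R p0 + (2 * (a + u)) *\<^sub>R p2"
        using c by (simp add: p0_def p2_def algebra_simps)
      have "(a, b, c) = ?A \<or> (a, b, c) = p0 \<or> (a, b, c) = p2"
        using True by (intro vertex[OF A P(1) P(2) u(1) w _ _ eq]) auto
      then show ?thesis
        using A B P by metis
    next
      case outside: False
      \<comment> \<open>Again the coordinate of \<open>?A\<close>, now against \<open>?B\<close> and
        \<open>p0\<close>: the slack in \<open>edge1\<close> vanishes at those two and equals
        \<open>1 - tau\<close> at \<open>?A\<close>.\<close>
      define v where "v = (1 + a * (1 - 2 * tau) - c) / (1 - tau)"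
      have v: "0 \<le> v" "v * (1 - tau) = 1 + a * (1 - 2 * tau) - c"
        using edge1 tau_bounds by (simp_all add: v_def)
      have "u * (1 - tau) \<le> - a * (1 - tau)"
        using outside tau_bounds by (intro mult_right_mono) auto
      then have "v * (1 - tau) \<le> - a * (1 - tau)"
        using u(2) unfolding v(2) by (simp add: algebra_simps)
      then have "v \<le> - a"
        using tau_bounds by (elim mult_right_le_imp_le) simp
      then have w: "0 \<le> - a - v"
        by simp
      have c: "c = v * (3 * tau - 1) + (- a - v) * (2 * tau) + (1 + a)"
        using v(2) by (simp add: algebra_simps)
      have "b = v * (1 + 3 * tau) + (- a - v) * (2 * tau)"
      proof (rule b_eqI)
        have "(v * (1 + 3 * tau) + (- a - v) * (2 * tau)) * tau = (v - 2 * a) * (tau * tau) + v * tau"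
          by (simp add: algebra_simps)
        also have "\<dots> = 1 - c - a * (1 - 2 * tau)"
          unfolding tau by (subst c) (simp add: algebra_simps)
        finally show "(v * (1 + 3 * tau) + (- a - v) * (2 * tau)) * tau = 1 - c - a * (1 - 2 * tau)" .
      qed
      then have eq: "(a, b, c) = v *\<^sub>R ?A + (- a - v) *\<^sub>R ?B + (1 + a) *\<^sub>R p0"
        using c by (simp add: p0_def algebra_simps)
      have "(a, b, c) = ?A \<or> (a, b, c) = ?B \<or> (a, b, c) = p0"
        using bounds by (intro vertex[OF A B P(1) v(1) w _ _ eq]) auto
      then show ?thesis
        using A B P by metis
    qed
  qed
qed

text \<open>Raising \<open>b\<close> slightly breaks the bound somewhere, and only from above since
  \<open>x * y \<ge> 0\<close>; by compactness the violations accumulate at a contact point. On an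
  axis the contact says nothing about \<open>b\<close>, so its sign is read off from the approaching
  violations.\<close>

lemma upper_contact_exists:
  assumes in_ball: "(a, b, c) \<in> ball_Oct" and maximal: "\<And>e. 0 < e \<Longrightarrow> (a, b + e, c) \<notin> ball_Oct"
  obtains x y where "(x, y) \<in> Oct" "qform (a, b, c) x y = 1" "x = 0 \<or> y = 0 \<Longrightarrow> 0 \<le> b"
proof -
  define e :: "nat \<Rightarrow> real" where "e n = inverse (real (Suc n))" for n
  have e: "0 < e n" for n
    by (simp add: e_def)
  have "\<exists>z. z \<in> Oct \<and> 1 < qform (a, b + e n, c) (fst z) (snd z)" for n
  proof -
    obtain x y where xy: "(x, y) \<in> Oct" "1 < \<bar>qform (a, b + e n, c) x y\<bar>"
      using maximal[OF e[of n]] unfolding mem_ball_Oct by (auto simp: not_le)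
    have "0 \<le> e n * (x * y)"
      using xy(1) e[of n] by (simp add: mem_Oct)
    then have "- 1 \<le> qform (a, b + e n, c) x y"
      using ball_OctD(2)[OF in_ball xy(1)] by (simp add: qform_eq algebra_simps)
    then show ?thesis
      using xy by (intro exI[of _ "(x, y)"]) auto
  qed
  then obtain z where z: "\<And>n. z n \<in> Oct" "\<And>n. 1 < qform (a, b + e n, c) (fst (z n)) (snd (z n))"
    by metis
  obtain l s where l: "l \<in> Oct" "strict_mono s" "(z \<circ> s) \<longlonglongrightarrow> l"
    using compact_Oct z(1) unfolding compact_def by metis
  obtain x y where xy: "l = (x, y)"
    by (cases l)
  define X Y E where "X n = fst (z (s n))" and "Y n = snd (z (s n))" and "E n = e (s n)" for n
  have X: "X \<longlonglongrightarrow> x" and Y: "Y \<longlonglongrightarrow> y"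
    using tendsto_fst[OF l(3)] tendsto_snd[OF l(3)] by (simp_all add: X_def[abs_def] Y_def[abs_def] o_def xy)
  have "e \<longlonglongrightarrow> 0"
    unfolding e_def by (rule LIMSEQ_inverse_real_of_nat)
  from LIMSEQ_subseq_LIMSEQ[OF this l(2)] have E: "E \<longlonglongrightarrow> 0"
    by (simp add: E_def[abs_def] o_def)
  have XY: "0 \<le> X n" "0 \<le> Y n" "X n \<le> 1" "Y n \<le> 1" for n
    using z(1)[of "s n"] by (cases "z (s n)"; simp add: X_def Y_def mem_Oct)+
  have gt: "1 < a * (X n)\<^sup>2 + (b + E n) * X n * Y n + c * (Y n)\<^sup>2" for n
    using z(2)[of "s n"] by (simp add: qform_eq X_def Y_def E_def)

  have "(\<lambda>n. a * (X n)\<^sup>2 + (b + E n) * X n * Y n + c * (Y n)\<^sup>2) \<longlonglongrightarrow> a * x\<^sup>2 + (b + 0) * x * y + c * y\<^sup>2"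
    by (intro tendsto_intros X Y E)
  from LIMSEQ_le_const[OF this] gt have "1 \<le> qform (a, b, c) x y"
    by (force simp: qform_eq intro: less_imp_le)
  then have contact: "qform (a, b, c) x y = 1"
    using ball_OctD(1)[OF in_ball] l(1) xy by (simp add: order_antisym)

  have "0 \<le> b" if "x = 0 \<or> y = 0"
    using that
  proof
    assume y: "y = 0"
    \<comment> \<open>As \<open>a * (X n)^2\<close> is at most 1, the excess over 1 comes from the
      other terms, which share the factor \<open>Y n\<close>.\<close>
    have "0 \<le> (b + E n) * X n + c * Y n" for n
    proof -
      have "a * (X n)\<^sup>2 \<le> 1 * (X n)\<^sup>2"
        using ball_Oct_coeff_bounds[OF in_ball] by (intro mult_right_mono) auto
      also have "\<dots> \<le> 1"
        using XY[of n] by (simp add: abs_square_le_1)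
      finally have "0 < Y n * ((b + E n) * X n + c * Y n)"
        using gt[of n] by (simp add: power2_eq_square algebra_simps)
      then show ?thesis
        using XY[of n] by (auto simp: zero_less_mult_iff)
    qed
    moreover have "(\<lambda>n. (b + E n) * X n + c * Y n) \<longlonglongrightarrow> (b + 0) * x + c * y"
      by (intro tendsto_intros X Y E)
    ultimately have "0 \<le> b * x"
      using LIMSEQ_le_const y by fastforce
    moreover have "0 < x"
      using contact y l(1) by (cases "x = 0") (auto simp: qform_eq xy mem_Oct)
    ultimately show ?thesis
      by (simp add: zero_le_mult_iff)
  next
    assume x: "x = 0"
    have "0 \<le> (b + E n) * Y n + a * X n" for n
    proof -
      have "c * (Y n)\<^sup>2 \<le> 1 * (Y n)\<^sup>2"
        using ball_Oct_coeff_bounds[OF in_ball] by (intro mult_right_mono) auto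
      also have "\<dots> \<le> 1"
        using XY[of n] by (simp add: abs_square_le_1)
      finally have "0 < X n * ((b + E n) * Y n + a * X n)"
        using gt[of n] by (simp add: power2_eq_square algebra_simps)
      then show ?thesis
        using XY[of n] by (auto simp: zero_less_mult_iff)
    qed
    moreover have "(\<lambda>n. (b + E n) * Y n + a * X n) \<longlonglongrightarrow> (b + 0) * y + a * x"
      by (intro tendsto_intros X Y E)
    ultimately have "0 \<le> b * y"
      using LIMSEQ_le_const x by fastforce
    moreover have "0 < y"
      using contact x l(1) by (cases "y = 0") (auto simp: qform_eq xy mem_Oct)
    ultimately show ?thesis
      by (simp add: zero_le_mult_iff)
  qed
  then show thesis
    using that l(1) contact xy by blast
qed

text \<open>Otherwise the point could be scaled outwards within \<open>Oct\<close>, and by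
  homogeneity the value would exceed 1.\<close>

lemma contact_on_outer_boundary:
  assumes in_ball: "p \<in> ball_Oct" and xy: "(x, y) \<in> Oct" and contact: "qform p x y = 1"
  shows "x = 1 \<or> y = 1 \<or> x + y = 1 + tau"
proof (rule ccontr)
  assume inside: "\<not> (x = 1 \<or> y = 1 \<or> x + y = 1 + tau)"
  \<comment> \<open>The gauge of \<open>Oct\<close> at the point: division by \<open>m\<close> moves
    it to the outer boundary.\<close>
  define m where "m = max (max x y) ((x + y) / (1 + tau))"
  have "x \<noteq> 0 \<or> y \<noteq> 0"
    using contact by (cases p) (auto simp: qform_eq)
  then have m: "0 < m" "m < 1" "x \<le> m" "y \<le> m" "(x + y) / (1 + tau) \<le> m"
    using inside xy tau_bounds by (auto simp: m_def mem_Oct)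
  then have "x + y \<le> m * (1 + tau)"
    using tau_bounds by (simp add: pos_divide_le_eq)
  then have "(x / m, y / m) \<in> Oct"
    using m xy by (auto simp: mem_Oct pos_divide_le_eq mult.commute simp flip: add_divide_distrib)
  then have "qform p (x / m) (y / m) \<le> 1"
    by (rule ball_OctD(1)[OF in_ball])
  moreover have "qform p (x / m) (y / m) = qform p x y / m\<^sup>2"
    using m by (cases p) (simp add: qform_eq power2_eq_square field_simps)
  ultimately have "1 \<le> m\<^sup>2"
    using m contact by simp
  then show False
    using m abs_square_less_1[of m] by simp
qed

lemma extreme_x_edge_contact_listed:
  assumes p: "(a, b, c) extreme_point_of ball_Oct" and contact: "qform (a, b, c) 1 y0 = 1"
    and y0: "0 \<le> y0" "y0 \<le> tau" "y0 = 0 \<Longrightarrow> 0 \<le> b"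
  shows "(a, b, c) \<in> listed_points"
proof -
  have in_ball: "(a, b, c) \<in> ball_Oct"
    using p by (simp add: extreme_point_of_def)
  have nonneg: "0 \<le> - c * y\<^sup>2 + - b * y + (1 - a)" if "0 \<le> y" "y \<le> tau" for y
    using ball_OctD(1)[OF in_ball, of 1 y] that tau_bounds by (simp add: mem_Oct qform_eq)
  have zero: "- c * y0\<^sup>2 + - b * y0 + (1 - a) = 0"
    using contact by (simp add: qform_eq)
  consider "y0 = 0" | "0 < y0" "y0 < tau" | "y0 = tau"
    using y0 by linarith
  then show ?thesis
  proof cases
    case 1
    \<comment> \<open>The edge derivative at \<open>(1, 0)\<close> gives \<open>b \<le> 0\<close>,
      which meets the assumption \<open>0 \<le> b\<close>.\<close>
    have "0 \<le> (tau - 0) * (2 * (- c) * 0 + - b)"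
      using zero 1 tau_bounds by (intro one_sided_derivative_nonneg[OF nonneg]) auto
    then have b: "b = 0"
      using y0(3)[OF 1] tau_bounds by (simp add: mult_le_0_iff)
    have a: "a = 1"
      using zero 1 by simp
    have "c * tau\<^sup>2 \<le> 0"
      using nonneg[of tau] tau_bounds by (simp add: a b)
    then have "c \<le> 0"
      using tau_bounds by (simp add: mult_le_0_iff)
    then show ?thesis
      using y0 1 by (intro extreme_x_edge_contact[OF p, of "- c" 0]) (auto simp: a b)
  next
    case 2
    have "0 \<le> - c" "- b = - 2 * (- c) * y0" "1 - a = - c * y0\<^sup>2"
      by (rule nonneg_quadratic_interior_zero[OF _ 2 zero]; use nonneg in simp)+
    then show ?thesis
      using y0 by (intro extreme_x_edge_contact[OF p, of "- c" y0]) auto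
  next
    case 3
    then have "qform (c, b, a) tau 1 = 1"
      using contact by (simp add: qform_eq add.commute mult.commute)
    then have "(c, b, a) \<in> listed_points"
      using extreme_ball_Oct_transpose[OF p] by (intro extreme_vertex_contact) auto
    from transpose_form_listed_points[OF this] show ?thesis
      by simp
  qed
qed

lemma extreme_upper_listed:
  assumes p: "(a, b, c) extreme_point_of ball_Oct"
    and maximal: "\<And>e. 0 < e \<Longrightarrow> (a, b + e, c) \<notin> ball_Oct"
  shows "(a, b, c) \<in> listed_points"
proof -
  have in_ball: "(a, b, c) \<in> ball_Oct"
    using p by (simp add: extreme_point_of_def)
  obtain x0 y0 where xy: "(x0, y0) \<in> Oct" and contact: "qform (a, b, c) x0 y0 = 1"
    and b: "x0 = 0 \<or> y0 = 0 \<Longrightarrow> 0 \<le> b"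
    using upper_contact_exists[OF in_ball maximal] by metis
  consider "x0 = 1" | "y0 = 1" | "x0 < 1" "y0 < 1" "x0 + y0 = 1 + tau"
    using contact_on_outer_boundary[OF in_ball xy contact] xy unfolding mem_Oct by linarith
  then show ?thesis
  proof cases
    case 1
    then show ?thesis
      using contact xy b by (intro extreme_x_edge_contact_listed[OF p, of y0]) (auto simp: mem_Oct)
  next
    case 2
    have "(c, b, a) \<in> listed_points"
    proof (rule extreme_x_edge_contact_listed)
      show "(c, b, a) extreme_point_of ball_Oct"
        using extreme_ball_Oct_transpose[OF p] by simp
      show "qform (c, b, a) 1 x0 = 1"
        using contact 2 by (simp add: qform_eq algebra_simps)
    qed (use xy b 2 in \<open>auto simp: mem_Oct\<close>)
    from transpose_form_listed_points[OF this] show ?thesis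
      by simp
  next
    case 3
    define h where "h = 1 + tau"
    have h: "h * h = 2" and y0: "y0 = h - x0"
      using 3(3) by (simp_all add: h_def flip: sqrt2_eq)
    have nonneg: "0 \<le> (b - a - c) * x\<^sup>2 + (2 * c - b) * h * x + (1 - 2 * c)"
      if "tau \<le> x" "x \<le> 1" for x
    proof -
      have "qform (a, b, c) x (h - x) \<le> 1"
        using that tau_bounds by (intro ball_OctD(1)[OF in_ball]) (auto simp: mem_Oct h_def)
      also have "qform (a, b, c) x (h - x) = (a + c - b) * x\<^sup>2 - (2 * c - b) * h * x + c * (h * h)"
        by (simp add: qform_eq power2_eq_square algebra_simps)
      finally show ?thesis
        by (simp add: h algebra_simps)
    qed
    have "qform (a, b, c) x0 y0 = (a + c - b) * x0\<^sup>2 - (2 * c - b) * h * x0 + c * (h * h)"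
      by (simp add: y0 qform_eq power2_eq_square algebra_simps)
    then have zero: "(b - a - c) * x0\<^sup>2 + (2 * c - b) * h * x0 + (1 - 2 * c) = 0"
      using contact by (simp add: h algebra_simps)
    have x0: "tau < x0" "x0 < 1"
      using 3 by auto
    \<comment> \<open>On the diagonal edge \<open>1 - P\<close> is \<open>A * (x - x0)^2\<close>.
      Since \<open>y0 * x - x0 * y = h * (x - x0)\<close> there and \<open>h * h = 2\<close>, the
      multiplier of the squared linear form is \<open>A/2\<close>.\<close>
    define A where "A = b - a - c"
    have coeffs: "0 \<le> A" "(2 * c - b) * h = - 2 * A * x0" "1 - 2 * c = A * x0\<^sup>2"
      unfolding A_def
      by (rule nonneg_quadratic_interior_zero[OF _ x0 zero]; use nonneg in simp)+
    have c: "c = 1/2 - A/2 * x0\<^sup>2"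
      using coeffs(3) by simp
    have "2 * c - b = (2 * c - b) * (h * h) / 2"
      using h by simp
    also have "\<dots> = ((2 * c - b) * h) * h / 2"
      by simp
    also have "\<dots> = - A * x0 * h"
      unfolding coeffs(2) by simp
    finally have "b = 2 * c + A * x0 * h"
      by linarith
    also have "\<dots> = 1 + 2 * (A/2) * x0 * y0"
      unfolding c y0 by (simp add: power2_eq_square algebra_simps)
    finally have b: "b = 1 + 2 * (A/2) * x0 * y0" .
    have "a = b - c - A"
      by (simp add: A_def)
    also have "\<dots> = 1/2 - A/2 * (2 + x0\<^sup>2 - 2 * x0 * h)"
      unfolding b c y0 by (simp add: power2_eq_square algebra_simps)
    also have "2 + x0\<^sup>2 - 2 * x0 * h = y0\<^sup>2"
      using h by (simp add: y0 power2_eq_square algebra_simps)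
    finally have a: "a = 1/2 - A/2 * y0\<^sup>2" .
    show ?thesis
      using a b c coeffs(1) 3 xy by (intro extreme_diagonal_contact[OF p, of "A/2" y0 x0]) auto
  qed
qed

theorem theorem4p2:
  shows "{p. p extreme_point_of ball_Oct} =
    (\<Union>G\<in>{Gamma1, Gamma2, Gamma3, Gamma4}. G \<union> uminus ` G) \<union>
    {p0, -p0, p1, -p1, p2, -p2, p3, -p3}"
proof -
  have "p \<in> listed_points \<or> - p \<in> listed_points" if p: "p extreme_point_of ball_Oct" for p
  proof -
    obtain a b c where abc: "p = (a, b, c)"
      by (cases p)
    show ?thesis
    proof (cases "\<forall>e>0. (a, b + e, c) \<notin> ball_Oct")
      case True
      then show ?thesis
        using extreme_upper_listed p abc by blast
    next
      case False
      then obtain e where e: "0 < e" "(a, b + e, c) \<in> ball_Oct"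
        by blast
      \<comment> \<open>If \<open>b\<close> can be raised, extremality forbids lowering it, so
        \<open>- p\<close> has maximal middle coefficient.\<close>
      have "(- a, - b + f, - c) \<notin> ball_Oct" if f: "0 < f" for f
      proof
        assume "(- a, - b + f, - c) \<in> ball_Oct"
        from uminus_ball_Oct[OF this] have "(a, b - f, c) \<in> ball_Oct"
          by simp
        moreover define w where "w = f / (e + f)"
        have "w * (e + f) = f"
          using e f by (simp add: w_def)
        then have "p = (1 - w) *\<^sub>R (a, b - f, c) + w *\<^sub>R (a, b + e, c)"
          by (simp add: abc algebra_simps)
        ultimately have "w = 0 \<or> w = 1"
          using e f by (intro extreme_point_of_segment_endpoint[OF p, of "(a, b - f, c)" "(a, b + e, c)"]) (auto simp: w_def)
        then show False
          using e f by (simp add: w_def)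
      qed
      then have "(- a, - b, - c) \<in> listed_points"
        using extreme_ball_Oct_uminus[OF p] by (intro extreme_upper_listed) (auto simp: abc)
      then show ?thesis
        by (simp add: abc)
    qed
  qed
  moreover have "p extreme_point_of ball_Oct" if "p \<in> listed_points \<or> - p \<in> listed_points" for p
    using that listed_points_extreme extreme_ball_Oct_uminus[of "- p"] by (metis minus_minus)
  ultimately have "{p. p extreme_point_of ball_Oct} = {p. p \<in> listed_points \<or> - p \<in> listed_points}"
    by blast
  also have "\<dots> = listed_points \<union> uminus ` listed_points"
    by (force simp: image_iff)
  finally show ?thesis
    by (simp add: listed_points_def image_Un) blast
qed

end
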